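(* Let $X$ be a real Hilbert space, let $T\colon X\to X$ be firmly nonexpansive, let $A\colon X\rightrightarrows X$ be maximally monotone, and suppose that $T=J_A$, or equivalently that $A=T^{-1}-\mathrm{Id}$. Then the following are equivalent: (i) $T$ is strictly nonexpansive and injective. (ii) $A$ is at most single-valued and disjointly injective. (iii) $\mathrm{Id}-T$ is strictly nonexpansive and injective. (iv) $A^{-1}$ is at most single-valued and disjointly injective. Consequently, being both strictly nonexpansive and injective is a self-dual property for firmly nonexpansive mappings; correspondingly, being both disjointly injective and at most single-valued is self-dual for maximally monotone operators.
   Context: $X$ is a real Hilbert space; $\mathrm{Id}$ is the identity on $X$. $T\colon X\to X$ is firmly nonexpansive if $\|Tx-Ty\|^2+\|(\mathrm{Id}-T)x-(\mathrm{Id}-T)y\|^2\leq\|x-y\|^2$ for all $x,y\in X$; it is strictly nonexpansive if $x\neq y\Rightarrow\|Tx-Ty\|<\|x-y\|$ for all $x,y\in X$. For $A\colon X\rightrightarrows X$ (so $Ax\subseteq X$ for each $x$): $\operatorname{gr}A=\{(x,u):u\in Ax\}$ and $x\in A^{-1}u\Leftrightarrow u\in Ax$. $A$ is at most single-valued if each $Ax$ has at most one element; $A$ is disjointly injective if $x\neq y\Rightarrow Ax\cap Ay=\varnothing$ for all $x,y\in X$. $A$ is monotone if $\langle x-y,u-v\rangle\geq0$ for all $(x,u),(y,v)\in\operatorname{gr}A$, and maximally monotone if it is monotone with no proper monotone extension. The resolvent of a maximally monotone $A$ is $J_A=(\mathrm{Id}+A)^{-1}\colon X\to X$. A property of firmly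 nonexpansive mappings on $X$ is self-dual if, for every firmly nonexpansive $T\colon X\to X$, $T$ has it if and only if $\mathrm{Id}-T$ has it; a property of maximally monotone operators on $X$ is self-dual if, for every maximally monotone $A$, $A$ has it if and only if $A^{-1}$ has it. *)

theory Defs
  imports "HOL-Analysis.Analysis"
begin

definition firmly_nonexpansive :: "('a::real_inner \<Rightarrow> 'a) \<Rightarrow> bool" where
  "firmly_nonexpansive T \<longleftrightarrow>
     (\<forall>x y. (norm (T x - T y))\<^sup>2 + (norm ((x - T x) - (y - T y)))\<^sup>2 \<le> (norm (x - y))\<^sup>2)"

definition strictly_nonexpansive :: "('a::real_inner \<Rightarrow> 'a) \<Rightarrow> bool" where
  "strictly_nonexpansive T \<longleftrightarrow> (\<forall>x y. x \<noteq> y \<longrightarrow> norm (T x - T y) < norm (x - y))"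

(* A set-valued operator on X is a function A :: 'a \<Rightarrow> 'a set; A x may be empty. *)

definition gr :: "('a \<Rightarrow> 'b set) \<Rightarrow> ('a \<times> 'b) set" where
  "gr A = {(x, u). u \<in> A x}"

definition op_inverse :: "('a \<Rightarrow> 'b set) \<Rightarrow> 'b \<Rightarrow> 'a set" where
  "op_inverse A u = {x. u \<in> A x}"

definition op_of_fun :: "('a \<Rightarrow> 'b) \<Rightarrow> 'a \<Rightarrow> 'b set" where
  "op_of_fun T x = {T x}"

definition op_plus :: "('a \<Rightarrow> 'b::ab_group_add set) \<Rightarrow> ('a \<Rightarrow> 'b set) \<Rightarrow> 'a \<Rightarrow> 'b set" where
  "op_plus A B x = {u + v | u v. u \<in> A x \<and> v \<in> B x}"

definition op_minus :: "('a \<Rightarrow> 'b::ab_group_add set) \<Rightarrow> ('a \<Rightarrow> 'b set) \<Rightarrow> 'a \<Rightarrow> 'b set" where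
  "op_minus A B x = {u - v | u v. u \<in> A x \<and> v \<in> B x}"

definition at_most_single_valued :: "('a \<Rightarrow> 'b set) \<Rightarrow> bool" where
  "at_most_single_valued A \<longleftrightarrow> (\<forall>x u v. u \<in> A x \<longrightarrow> v \<in> A x \<longrightarrow> u = v)"

definition disjointly_injective :: "('a \<Rightarrow> 'b set) \<Rightarrow> bool" where
  "disjointly_injective A \<longleftrightarrow> (\<forall>x y. x \<noteq> y \<longrightarrow> A x \<inter> A y = {})"

definition monotone_operator :: "('a::real_inner \<Rightarrow> 'a set) \<Rightarrow> bool" where
  "monotone_operator A \<longleftrightarrow> (\<forall>(x, u) \<in> gr A. \<forall>(y, v) \<in> gr A. 0 \<le> (x - y) \<bullet> (u - v))"

definition maximally_monotone :: "('a::real_inner \<Rightarrow> 'a set) \<Rightarrow> bool" where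
  "maximally_monotone A \<longleftrightarrow>
     monotone_operator A \<and> \<not> (\<exists>B. monotone_operator B \<and> gr A \<subset> gr B)"

(* Kept set-valued: that a function T is the resolvent of A reads op_of_fun T = resolvent A. *)
definition resolvent :: "('a::real_inner \<Rightarrow> 'a set) \<Rightarrow> 'a \<Rightarrow> 'a set" where
  "resolvent A = op_inverse (op_plus (op_of_fun id) A)"

definition self_dual_firmly_nonexpansive :: "(('a::real_inner \<Rightarrow> 'a) \<Rightarrow> bool) \<Rightarrow> bool" where
  "self_dual_firmly_nonexpansive P \<longleftrightarrow>
     (\<forall>T. firmly_nonexpansive T \<longrightarrow> (P T \<longleftrightarrow> P (\<lambda>x. x - T x)))"

definition self_dual_maximally_monotone :: "(('a::real_inner \<Rightarrow> 'a set) \<Rightarrow> bool) \<Rightarrow> bool" where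
  "self_dual_maximally_monotone P \<longleftrightarrow>
     (\<forall>A. maximally_monotone A \<longrightarrow> (P A \<longleftrightarrow> P (op_inverse A)))"

end

theory Submission
  imports Defs
begin

text \<open>
  If \<open>T\<close> is firmly nonexpansive, then \<open>\<parallel>T x - T y\<parallel> = \<parallel>x - y\<parallel>\<close> only when
  \<open>x - T x = y - T y\<close>; hence \<open>T\<close> is strictly nonexpansive iff \<open>Id - T\<close> is injective, and
  dually with the roles of \<open>T\<close> and \<open>Id - T\<close> exchanged. On the operator side, \<open>T = J\<^sub>A\<close> says that
  \<open>u \<in> A x\<close> iff \<open>T (x + u) = x\<close>, so that \<open>A\<close> is at most single-valued iff \<open>T\<close> is injective and
  disjointly injective iff \<open>Id - T\<close> is injective.
\<close>

lemma firmly_nonexpansive_complement: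
  "firmly_nonexpansive T \<Longrightarrow> firmly_nonexpansive (\<lambda>x. x - T x)"
  by (simp add: firmly_nonexpansive_def add.commute)

lemma strictly_nonexpansive_iff_inj_complement:
  assumes "firmly_nonexpansive T"
  shows "strictly_nonexpansive T \<longleftrightarrow> inj (\<lambda>x. x - T x)"
proof
  assume strict: "strictly_nonexpansive T"
  show "inj (\<lambda>x. x - T x)"
  proof (rule injI)
    fix x y
    assume "x - T x = y - T y"
    \<comment> \<open>Equal values of the complement make \<open>T\<close> preserve this difference,
      and hence its norm, which strictness allows only for \<open>x = y\<close>.\<close>
    then have "T x - T y = x - y"
      by (simp add: algebra_simps)
    then show "x = y"
      using strict unfolding strictly_nonexpansive_def by (metis less_irrefl)
  qed
next
  assume inj: "inj (\<lambda>x. x - T x)"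
  show "strictly_nonexpansive T"
    unfolding strictly_nonexpansive_def
  proof (intro allI impI)
    fix x y :: 'a
    assume "x \<noteq> y"
    with inj have "(x - T x) - (y - T y) \<noteq> 0"
      by (auto dest: injD)
    \<comment> \<open>This term is the gap in the firm nonexpansiveness inequality; its positivity
      makes the bound on \<open>T x - T y\<close> strict.\<close>
    then have "0 < (norm ((x - T x) - (y - T y)))\<^sup>2"
      by simp
    moreover have "(norm (T x - T y))\<^sup>2 + (norm ((x - T x) - (y - T y)))\<^sup>2 \<le> (norm (x - y))\<^sup>2"
      using assms unfolding firmly_nonexpansive_def by blast
    ultimately have "(norm (T x - T y))\<^sup>2 < (norm (x - y))\<^sup>2"
      by linarith
    then show "norm (T x - T y) < norm (x - y)"
      by (rule power_less_imp_less_base) simp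
  qed
qed

lemma strictly_nonexpansive_complement_iff_inj:
  "firmly_nonexpansive T \<Longrightarrow> strictly_nonexpansive (\<lambda>x. x - T x) \<longleftrightarrow> inj T"
  using strictly_nonexpansive_iff_inj_complement[OF firmly_nonexpansive_complement, of T]
  by simp

lemma at_most_single_valued_op_inverse [simp]:
  "at_most_single_valued (op_inverse A) \<longleftrightarrow> disjointly_injective A"
  by (auto simp: at_most_single_valued_def disjointly_injective_def op_inverse_def)

lemma disjointly_injective_op_inverse [simp]:
  "disjointly_injective (op_inverse A) \<longleftrightarrow> at_most_single_valued A"
  by (auto simp: at_most_single_valued_def disjointly_injective_def op_inverse_def)

lemma mem_resolvent_iff: "y \<in> resolvent A x \<longleftrightarrow> x - y \<in> A y"
  by (force simp: resolvent_def op_inverse_def op_plus_def op_of_fun_def)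

text \<open>The pointwise right-hand side is the common form to which both relations between
  \<open>T\<close> and \<open>A\<close> are reduced, which makes them equivalent.\<close>

lemma op_of_fun_eq_resolvent_iff:
  "op_of_fun T = resolvent A \<longleftrightarrow> (\<forall>x u. u \<in> A x \<longleftrightarrow> T (x + u) = x)"
proof
  assume "op_of_fun T = resolvent A"
  then have "y \<in> {T x} \<longleftrightarrow> x - y \<in> A y" for x y
    by (metis mem_resolvent_iff op_of_fun_def)
  \<comment> \<open>Evaluating at \<open>x + u\<close> turns the difference in the membership
    condition into \<open>u\<close>.\<close>
  from this[of x "x + u" for x u] show "\<forall>x u. u \<in> A x \<longleftrightarrow> T (x + u) = x"
    by (simp add: eq_commute)
next
  assume "\<forall>x u. u \<in> A x \<longleftrightarrow> T (x + u) = x"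
  then have "y \<in> resolvent A x \<longleftrightarrow> y = T x" for x y
    by (auto simp: mem_resolvent_iff)
  then show "op_of_fun T = resolvent A"
    by (auto simp: op_of_fun_def fun_eq_iff)
qed

lemma eq_op_inverse_minus_id_iff:
  "A = op_minus (op_inverse (op_of_fun T)) (op_of_fun id) \<longleftrightarrow>
    (\<forall>x u. u \<in> A x \<longleftrightarrow> T (x + u) = x)"
proof -
  have "u \<in> op_minus (op_inverse (op_of_fun T)) (op_of_fun id) x \<longleftrightarrow> T (x + u) = x" for x u
    unfolding op_minus_def op_inverse_def op_of_fun_def
    by simp (metis add.commute add_diff_cancel_left' diff_add_cancel)
  then show ?thesis
    by (auto simp: fun_eq_iff set_eq_iff)
qed

text \<open>The map sending \<open>a\<close> to \<open>(T a, a - T a)\<close> is a bijection onto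
  \<open>gr A\<close> with inverse \<open>(x, u)\<close> to \<open>x + u\<close> (Minty
  parametrization). Both sides say that the first coordinate determines the point of the
  graph.\<close>

lemma at_most_single_valued_iff_inj_resolvent:
  assumes "op_of_fun T = resolvent A"
  shows "at_most_single_valued A \<longleftrightarrow> inj T"
proof -
  have A: "u \<in> A x \<longleftrightarrow> T (x + u) = x" for x u
    using assms by (simp add: op_of_fun_eq_resolvent_iff)
  show ?thesis
  proof
    assume sv: "at_most_single_valued A"
    show "inj T"
    proof (rule injI)
      fix a b
      assume "T a = T b"
      then have "a - T a \<in> A (T a)" "b - T a \<in> A (T a)"
        by (simp_all add: A)
      then have "a - T a = b - T a"
        using sv unfolding at_most_single_valued_def by blast
      then show "a = b"
        by simp
    qed
  next
    assume "inj T"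
    then show "at_most_single_valued A"
      unfolding at_most_single_valued_def A by (metis add_left_cancel injD)
  qed
qed

text \<open>In the same parametrization of \<open>gr A\<close>, both sides say that the second
  coordinate determines the point.\<close>

lemma disjointly_injective_iff_inj_complement_resolvent:
  assumes "op_of_fun T = resolvent A"
  shows "disjointly_injective A \<longleftrightarrow> inj (\<lambda>x. x - T x)"
proof -
  have A: "u \<in> A x \<longleftrightarrow> T (x + u) = x" for x u
    using assms by (simp add: op_of_fun_eq_resolvent_iff)
  show ?thesis
  proof
    assume di: "disjointly_injective A"
    show "inj (\<lambda>x. x - T x)"
    proof (rule injI)
      fix a b
      assume eq: "a - T a = b - T b"
      have "a - T a \<in> A (T a)" "b - T b \<in> A (T b)"
        by (simp_all add: A)
      with eq di have "T a = T b"
        unfolding disjointly_injective_def by (metis disjoint_iff)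
      with eq show "a = b"
        by simp
    qed
  next
    assume inj: "inj (\<lambda>x. x - T x)"
    have "x = y" if "u \<in> A x" "u \<in> A y" for x y u
    proof -
      \<comment> \<open>The graph points \<open>(x, u)\<close> and \<open>(y, u)\<close> have
        parameters \<open>x + u\<close> and \<open>y + u\<close>; both sides equal
        \<open>u\<close>.\<close>
      from that have "x + u - T (x + u) = y + u - T (y + u)"
        by (simp add: A)
      with inj have "x + u = y + u"
        by (rule injD)
      then show ?thesis
        by simp
    qed
    then show "disjointly_injective A"
      by (auto simp: disjointly_injective_def)
  qed
qed

text \<open>Each of the four conditions becomes the conjunction of \<open>inj T\<close> and
  \<open>inj (\<lambda>x. x - T x)\<close>. Self-duality for operators holds because
  \<open>op_inverse\<close> swaps the two conjuncts.\<close>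

theorem theorem3p6:
  shows "(\<forall>(T :: 'a::{real_inner, complete_space} \<Rightarrow> 'a) (A :: 'a \<Rightarrow> 'a set).
            firmly_nonexpansive T \<longrightarrow> maximally_monotone A \<longrightarrow>
              (op_of_fun T = resolvent A \<longleftrightarrow>
                 A = op_minus (op_inverse (op_of_fun T)) (op_of_fun id)) \<and>
              (op_of_fun T = resolvent A \<longrightarrow>
                 (strictly_nonexpansive T \<and> inj T \<longleftrightarrow>
                    at_most_single_valued A \<and> disjointly_injective A) \<and>
                 (at_most_single_valued A \<and> disjointly_injective A \<longleftrightarrow>
                    strictly_nonexpansive (\<lambda>x. x - T x) \<and> inj (\<lambda>x. x - T x)) \<and>
                 (strictly_nonexpansive (\<lambda>x. x - T x) \<and> inj (\<lambda>x. x - T x) \<longleftrightarrow>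
                    at_most_single_valued (op_inverse A) \<and> disjointly_injective (op_inverse A))))
         \<and> self_dual_firmly_nonexpansive
              (\<lambda>T :: 'a \<Rightarrow> 'a. strictly_nonexpansive T \<and> inj T)
         \<and> self_dual_maximally_monotone
              (\<lambda>A :: 'a \<Rightarrow> 'a set. disjointly_injective A \<and> at_most_single_valued A)"
  by (auto simp: op_of_fun_eq_resolvent_iff[symmetric] eq_op_inverse_minus_id_iff
      at_most_single_valued_iff_inj_resolvent disjointly_injective_iff_inj_complement_resolvent
      strictly_nonexpansive_iff_inj_complement strictly_nonexpansive_complement_iff_inj
      self_dual_firmly_nonexpansive_def self_dual_maximally_monotone_def)

end
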